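(* Let $\mathrm{Var}$ be a denumerable set of propositional variables, let $\Gamma$ be a set of monoidal functional dependencies over $\mathrm{Var}$, and let $A \Rightarrow B$ be a monoidal functional dependency over $\mathrm{Var}$. If $\Gamma \vdash A \Rightarrow B$ (provability using the rules (Ax) and (Cut)), then $\Gamma \models A \Rightarrow B$ (semantic entailment over all integral commutative pomonoids).
   Context: Let $\mathrm{Var}$ be a fixed denumerable set (propositional variables). A finite multiset over $\mathrm{Var}$ is a map $A\colon \mathrm{Var} \to \mathbb{Z}$ with $A(p) \ge 0$ for all $p$ and $\{p : A(p) > 0\}$ finite. $AB$ denotes the multiset $(AB)(p) = A(p)+B(p)$. A monoidal functional dependency (MFD) is an expression $A \Rightarrow B$ with $A,B$ finite multisets over $\mathrm{Var}$. Semantics: an integral commutative pomonoid is $\mathbf{L} = \langle L,\le,\otimes,1\rangle$ where $\langle L,\otimes,1\rangle$ is a commutative monoid, $\le$ is a partial order on $L$, $\otimes$ is monotone with respect to $\le$, and $1$ is the greatest element. Powers: $a^0=1$, $a^{n+1} = a \otimes a^n$. An $\mathbf{L}$-evaluation is a map $e\colon \mathrm{Var} \to L$, extended to multisets by $e(A) = e(p_1)^{A(p_1)} \otimes\cdots\otimes e(p_n)^{A(p_n)}$ where $\{p : A(p)>0\} \subseteq \{p_1,\dots,p_n\}$ ($p_i$ distinct). Write $e \models A \Rightarrow B$ if $e(A) \le e(B)$. An $\mathbf{L}$-model of $\Gamma$ is an $\mathbf{L}$-evaluation $e$ with $e \models E \Rightarrow F$ for all $E \Rightarrow F \in \Gamma$.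 $\Gamma \models A \Rightarrow B$ means: for every integral commutative pomonoid $\mathbf{L}$ and every $\mathbf{L}$-model $e$ of $\Gamma$, $e \models A \Rightarrow B$. Provability: the inference rules are, for arbitrary finite multisets $A,B,C,D$: (Ax) infer $AB \Rightarrow B$ (from no premises); (Cut) from $A \Rightarrow B$ and $BC \Rightarrow D$ infer $AC \Rightarrow D$. A proof of $\varphi_n$ by $\Gamma$ is a finite sequence $\varphi_1,\dots,\varphi_n$ of MFDs in which each $\varphi_i$ is in $\Gamma$ or is derived from $\varphi_1,\dots,\varphi_{i-1}$ by (Ax) or (Cut). $\Gamma \vdash A \Rightarrow B$ means there is a proof of $A \Rightarrow B$ by $\Gamma$. *)

theory Defs
  imports "HOL-Algebra.FiniteProduct" "HOL-Library.Multiset" "HOL-Library.Countable_Set"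
begin

text \<open>
  The variables are the elements of a type \<open>'v\<close>; that there are denumerably many
  of them is assumed where needed. The multiset written \<open>AB\<close> informally is \<open>A + B\<close>.
\<close>

datatype 'v mfd = MFD "'v multiset" "'v multiset" (infix "\<Rrightarrow>" 55)


subsection \<open>Provability\<close>

text \<open>\<open>inferred S \<phi>\<close>: one application of a rule, with all premises taken from \<open>S\<close>, yields \<open>\<phi>\<close>.\<close>

inductive inferred :: "'v mfd set \<Rightarrow> 'v mfd \<Rightarrow> bool" for S where
  Ax: "inferred S (A + B \<Rrightarrow> B)"
| Cut: "(A \<Rrightarrow> B) \<in> S \<Longrightarrow> (B + C \<Rrightarrow> D) \<in> S \<Longrightarrow> inferred S (A + C \<Rrightarrow> D)"

definition is_proof :: "'v mfd set \<Rightarrow> 'v mfd list \<Rightarrow> bool" where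
  "is_proof \<Gamma> \<phi>s \<longleftrightarrow>
     (\<forall>i < length \<phi>s. \<phi>s ! i \<in> \<Gamma> \<or> inferred (set (take i \<phi>s)) (\<phi>s ! i))"

definition provable :: "'v mfd set \<Rightarrow> 'v mfd \<Rightarrow> bool" (infix "\<turnstile>" 50) where
  "\<Gamma> \<turnstile> \<phi> \<longleftrightarrow> (\<exists>\<phi>s. \<phi>s \<noteq> [] \<and> is_proof \<Gamma> \<phi>s \<and> last \<phi>s = \<phi>)"


subsection \<open>Semantics\<close>

record 'l pomonoid = "'l monoid" +
  leq :: "'l \<Rightarrow> 'l \<Rightarrow> bool" (infix "\<preceq>\<index>" 50)

locale integral_comm_pomonoid = comm_monoid L for L (structure) +
  assumes leq_refl: "x \<in> carrier L \<Longrightarrow> x \<preceq> x"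
    and leq_antisym:
      "\<lbrakk>x \<preceq> y; y \<preceq> x; x \<in> carrier L; y \<in> carrier L\<rbrakk> \<Longrightarrow> x = y"
    and leq_trans:
      "\<lbrakk>x \<preceq> y; y \<preceq> z; x \<in> carrier L; y \<in> carrier L; z \<in> carrier L\<rbrakk> \<Longrightarrow> x \<preceq> z"
    and mult_mono:
      "\<lbrakk>x \<preceq> x'; y \<preceq> y'; x \<in> carrier L; x' \<in> carrier L; y \<in> carrier L; y' \<in> carrier L\<rbrakk>
         \<Longrightarrow> x \<otimes> y \<preceq> x' \<otimes> y'"
    and leq_one: "x \<in> carrier L \<Longrightarrow> x \<preceq> \<one>"

definition evaluation :: "('l, 'm) pomonoid_scheme \<Rightarrow> ('v \<Rightarrow> 'l) \<Rightarrow> bool" where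
  "evaluation L e \<longleftrightarrow> (\<forall>p. e p \<in> carrier L)"

definition eval_mset :: "('l, 'm) pomonoid_scheme \<Rightarrow> ('v \<Rightarrow> 'l) \<Rightarrow> 'v multiset \<Rightarrow> 'l" where
  "eval_mset L e A = (\<Otimes>\<^bsub>L\<^esub>p\<in>set_mset A. e p [^]\<^bsub>L\<^esub> count A p)"

text \<open>Any finite set of variables containing the support of \<open>A\<close> gives the same value.\<close>

lemma (in integral_comm_pomonoid) eval_mset_superset:
  assumes "evaluation L e" "finite P" "set_mset A \<subseteq> P"
  shows "eval_mset L e A = (\<Otimes>p\<in>P. e p [^] count A p)"
  unfolding eval_mset_def
  by (rule finprod_mono_neutral_cong_left)
     (use assms in \<open>auto simp: evaluation_def not_in_iff\<close>)

primrec satisfies :: "('l, 'm) pomonoid_scheme \<Rightarrow> ('v \<Rightarrow> 'l) \<Rightarrow> 'v mfd \<Rightarrow> bool" where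
  "satisfies L e (A \<Rrightarrow> B) \<longleftrightarrow> eval_mset L e A \<preceq>\<^bsub>L\<^esub> eval_mset L e B"

definition model_of :: "('l, 'm) pomonoid_scheme \<Rightarrow> ('v \<Rightarrow> 'l) \<Rightarrow> 'v mfd set \<Rightarrow> bool" where
  "model_of L e \<Gamma> \<longleftrightarrow> evaluation L e \<and> (\<forall>\<phi>\<in>\<Gamma>. satisfies L e \<phi>)"

text \<open>
  HOL cannot quantify over types inside a formula, so the type \<open>'l\<close> in which the pomonoids
  have their carriers is an explicit parameter. A theorem stated for a type variable \<open>'l\<close>
  concerns all integral commutative pomonoids.
\<close>

definition entails :: "'l itself \<Rightarrow> 'v mfd set \<Rightarrow> 'v mfd \<Rightarrow> bool" where
  "entails (_ :: 'l itself) \<Gamma> \<phi> \<longleftrightarrow>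
     (\<forall>(L :: 'l pomonoid) e. integral_comm_pomonoid L \<longrightarrow> model_of L e \<Gamma> \<longrightarrow> satisfies L e \<phi>)"

end

theory Submission imports Defs begin

text \<open>Fix a pomonoid and a model \<open>e\<close> of \<Gamma>. The extension of
  \<open>e\<close> to multisets turns sums into products (\<open>eval_mset_add\<close>), so each
  rule becomes an inequality in the pomonoid. With a, b, c, d the values of the multisets, (Ax) says
  that a b \<le> 1 b = b, which is integrality with monotonicity, and (Cut) is the chain a c \<le> b
  c \<le> d. Truth under \<open>e\<close> therefore passes from premises to conclusions
  (\<open>inferred_sound\<close>), and induction along the proof sequence carries it to the last
  formula (\<open>is_proof_sound\<close>).\<close>

context integral_comm_pomonoid
begin

lemma eval_mset_closed:
  assumes "evaluation L e"
  shows "eval_mset L e A \<in> carrier L"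
  using assms unfolding eval_mset_def evaluation_def by (intro finprod_closed) auto

text \<open>Over the common index set \<open>?P\<close>, exponents add pointwise and commutativity
  splits the product. Enlarging the supports of \<open>A\<close> and \<open>B\<close> to
  \<open>?P\<close> only adds factors with exponent 0.\<close>

lemma eval_mset_add:
  assumes e: "evaluation L e"
  shows "eval_mset L e (A + B) = eval_mset L e A \<otimes> eval_mset L e B"
proof -
  let ?P = "set_mset (A + B)"
  have "(\<Otimes>p\<in>?P. e p [^] count (A + B) p)
      = (\<Otimes>p\<in>?P. e p [^] count A p \<otimes> e p [^] count B p)"
    using e by (intro finprod_cong') (auto simp: evaluation_def nat_pow_mult)
  also have "\<dots> = (\<Otimes>p\<in>?P. e p [^] count A p) \<otimes> (\<Otimes>p\<in>?P. e p [^] count B p)"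
    using e by (intro finprod_multf) (auto simp: evaluation_def)
  finally show ?thesis
    using e by (simp add: eval_mset_superset[of e ?P])
qed

text \<open>The premise set \<open>S\<close> is arbitrary so that it can later be the set of
  formulas preceding a given position of a proof.\<close>

lemma inferred_sound:
  assumes "inferred S \<phi>" and e: "evaluation L e" and S: "\<And>\<psi>. \<psi> \<in> S \<Longrightarrow> satisfies L e \<psi>"
  shows "satisfies L e \<phi>"
  using assms(1)
proof cases
  case (Ax A B)
  note closed = eval_mset_closed[OF e]
  \<comment> \<open>Integrality enters here: the value of \<open>A\<close> lies below the
    unit.\<close>
  have "eval_mset L e A \<otimes> eval_mset L e B \<preceq> \<one> \<otimes> eval_mset L e B"
    by (intro mult_mono leq_one leq_refl closed one_closed)
  then show ?thesis using Ax closed by (simp add: eval_mset_add e)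
next
  case (Cut A B C D)
  note closed = eval_mset_closed[OF e]
  have AB: "eval_mset L e A \<preceq> eval_mset L e B"
    and BC: "eval_mset L e B \<otimes> eval_mset L e C \<preceq> eval_mset L e D"
    using S[OF Cut(2)] S[OF Cut(3)] by (simp_all add: eval_mset_add e)
  have "eval_mset L e A \<otimes> eval_mset L e C \<preceq> eval_mset L e B \<otimes> eval_mset L e C"
    by (intro mult_mono AB leq_refl closed)
  then have "eval_mset L e A \<otimes> eval_mset L e C \<preceq> eval_mset L e D"
    using BC by (rule leq_trans) (simp_all add: closed)
  then show ?thesis using Cut(1) by (simp add: eval_mset_add e)
qed

text \<open>A cut may cite any earlier formulas, hence a claim about every position and a strong
  induction on it.\<close>

lemma is_proof_sound:
  assumes p: "is_proof \<Gamma> \<phi>s" and m: "model_of L e \<Gamma>" and "i < length \<phi>s"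
  shows "satisfies L e (\<phi>s ! i)"
  using \<open>i < length \<phi>s\<close>
proof (induction i rule: less_induct)
  case (less i)
  from p less.prems consider "\<phi>s ! i \<in> \<Gamma>" | "inferred (set (take i \<phi>s)) (\<phi>s ! i)"
    unfolding is_proof_def by blast
  then show ?case
  proof cases
    case 1
    then show ?thesis using m by (simp add: model_of_def)
  next
    case 2
    then show ?thesis
    proof (rule inferred_sound)
      show "evaluation L e" using m by (simp add: model_of_def)
      show "satisfies L e \<psi>" if "\<psi> \<in> set (take i \<phi>s)" for \<psi>
        \<comment> \<open>A member of the prefix sits at some position below \<open>i\<close>, where
          the induction hypothesis applies.\<close>
        using that less by (auto simp: in_set_conv_nth)
    qed
  qed
qed

end

theorem theorem2:
  fixes \<Gamma> :: "'v mfd set" and A B :: "'v multiset"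
  assumes "countable (UNIV :: 'v set)" and "infinite (UNIV :: 'v set)"
    and "\<Gamma> \<turnstile> (A \<Rrightarrow> B)"
  shows "entails TYPE('l) \<Gamma> (A \<Rrightarrow> B)"
proof -
  from assms(3) obtain \<phi>s where \<phi>s: "\<phi>s \<noteq> []" "is_proof \<Gamma> \<phi>s" "last \<phi>s = (A \<Rrightarrow> B)"
    unfolding provable_def by blast
  show ?thesis
    unfolding entails_def
  proof (intro allI impI)
    fix L :: "'l pomonoid" and e
    assume "integral_comm_pomonoid L" and m: "model_of L e \<Gamma>"
    then interpret integral_comm_pomonoid L by simp
    show "satisfies L e (A \<Rrightarrow> B)"
      using is_proof_sound[OF \<phi>s(2) m, of "length \<phi>s - 1"] \<phi>s(1,3) by (simp add: last_conv_nth)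
  qed
qed

end
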